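(* Let $(P,\omega)$ be a symplectic manifold, $H\colon P\to\mathbb{R}$ a smooth function with Hamiltonian vector field $Z$, and let $\alpha\colon M\to P$ be an embedding of a manifold $M$. (1) If $\alpha$ is a solution of the slicing equation for $Z$ (that is, $Z$ is tangent to $\alpha(M)$) and satisfies the isotropy condition $\alpha^*(\omega)=0$, then $$\mathrm{d}\,\alpha^*(H)=0.$$ (2) Conversely, if $\mathrm{d}\,\alpha^*(H)=0$ and $\alpha$ satisfies the Lagrangianity condition ($\alpha^*(\omega)=0$ and $\dim P=2\dim M$), then $\alpha$ is a solution of the slicing equation for $Z$.
   Context: All manifolds and maps are $C^\infty$. The Hamiltonian vector field $Z$ of $H$ is defined by $i_Z\omega=\mathrm{d}H$. A map $\alpha\colon M\to P$ is a solution of the slicing equation for $(P,Z)$ if there is a vector field $X$ on $M$ with $T\alpha\circ X=Z\circ\alpha$; when $\alpha$ is an embedding, $X$ is unique if it exists, and existence is equivalent to $Z$ being tangent to the submanifold $\alpha(M)$. Here $\alpha^*(H)=H\circ\alpha$. *)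

theory Defs
  imports "HOL-Analysis.Analysis"
begin

section \<open>Smooth maps between open subsets of vector spaces\<close>

text \<open>
  For an open subset \<open>S\<close> of a finite-dimensional space, \<open>Ck_on k S f\<close> says that \<open>f\<close> is \<open>k\<close> times
  continuously differentiable on \<open>S\<close>. Values of \<open>f\<close> outside \<open>S\<close> are irrelevant.
\<close>

primrec Ck_on :: "nat \<Rightarrow> 'e::real_normed_vector set \<Rightarrow> ('e \<Rightarrow> 'f::real_normed_vector) \<Rightarrow> bool" where
  "Ck_on 0 S f \<longleftrightarrow> continuous_on S f"
| "Ck_on (Suc k) S f \<longleftrightarrow>
     (\<forall>x\<in>S. f differentiable (at x)) \<and> (\<forall>a. Ck_on k S (\<lambda>x. frechet_derivative f (at x) a))"

definition smooth_on :: "'e::real_normed_vector set \<Rightarrow> ('e \<Rightarrow> 'f::real_normed_vector) \<Rightarrow> bool" where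
  "smooth_on S f \<longleftrightarrow> (\<forall>k. Ck_on k S f)"


section \<open>Manifolds\<close>

text \<open>
  A chart is a pair of its domain and its coordinate map; the values of the coordinate map outside
  the domain are irrelevant. The model space is an arbitrary finite-dimensional real normed
  space instead of a type of class \<open>euclidean_space\<close>, since the latter would exclude manifolds of
  dimension zero.
\<close>

type_synonym ('p, 'e) chart = "'p set \<times> ('p \<Rightarrow> 'e)"

record ('p, 'e) manifold =
  mtop :: "'p topology"
  atlas :: "('p, 'e) chart set"

abbreviation points :: "('p, 'e) manifold \<Rightarrow> 'p set" where
  "points M \<equiv> topspace (mtop M)"

definition chart_inv :: "('p, 'e) chart \<Rightarrow> 'e \<Rightarrow> 'p" where
  "chart_inv c = inv_into (fst c) (snd c)"

definition is_chart :: "'p topology \<Rightarrow> ('p, 'e::real_normed_vector) chart \<Rightarrow> bool" where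
  "is_chart T c \<longleftrightarrow> openin T (fst c) \<and> open (snd c ` fst c) \<and>
     homeomorphic_map (subtopology T (fst c)) (top_of_set (snd c ` fst c)) (snd c)"

definition compatible_charts ::
    "('p, 'e::real_normed_vector) chart \<Rightarrow> ('p, 'e) chart \<Rightarrow> bool" where
  "compatible_charts c d \<longleftrightarrow> smooth_on (snd c ` (fst c \<inter> fst d)) (snd d \<circ> chart_inv c)"

text \<open>The atlas is not required to be maximal.\<close>

definition smooth_manifold :: "('p, 'e::real_normed_vector) manifold \<Rightarrow> bool" where
  "smooth_manifold M \<longleftrightarrow>
     (\<exists>B::'e set. finite B \<and> span B = UNIV) \<and>
     Hausdorff_space (mtop M) \<and> second_countable (mtop M) \<and>
     (\<forall>c\<in>atlas M. is_chart (mtop M) c) \<and>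
     (\<Union>c\<in>atlas M. fst c) = points M \<and>
     (\<forall>c\<in>atlas M. \<forall>d\<in>atlas M. compatible_charts c d)"

definition mdim :: "('p, 'e::real_normed_vector) manifold \<Rightarrow> nat" where
  "mdim M = dim (UNIV :: 'e set)"

definition charts_at :: "('p, 'e) manifold \<Rightarrow> 'p \<Rightarrow> ('p, 'e) chart set" where
  "charts_at M p = {c \<in> atlas M. p \<in> fst c}"

definition chart_at :: "('p, 'e) manifold \<Rightarrow> 'p \<Rightarrow> ('p, 'e) chart" where
  "chart_at M p = (SOME c. c \<in> charts_at M p)"

definition smooth_map ::
    "('p, 'e::real_normed_vector) manifold \<Rightarrow> ('q, 'f::real_normed_vector) manifold \<Rightarrow> ('p \<Rightarrow> 'q) \<Rightarrow> bool"
  where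
  "smooth_map M N f \<longleftrightarrow> continuous_map (mtop M) (mtop N) f \<and>
     (\<forall>c\<in>atlas M. \<forall>d\<in>atlas N.
        smooth_on (snd c ` {p \<in> fst c. f p \<in> fst d}) (snd d \<circ> f \<circ> chart_inv c))"

definition smooth_function :: "('p, 'e::real_normed_vector) manifold \<Rightarrow> ('p \<Rightarrow> real) \<Rightarrow> bool" where
  "smooth_function M h \<longleftrightarrow> (\<forall>c\<in>atlas M. smooth_on (snd c ` fst c) (h \<circ> chart_inv c))"


section \<open>Tangent vectors and vector fields\<close>

text \<open>
  A tangent vector at \<open>p\<close> assigns to each chart around \<open>p\<close> its components in that chart, subject to
  the usual transformation law under change of coordinates. It vanishes on all other charts, so that
  equality of tangent vectors is equality of functions; vector operations are pointwise.
\<close>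

type_synonym ('p, 'e) tangent = "('p, 'e) chart \<Rightarrow> 'e"

definition tangent_space ::
    "('p, 'e::real_normed_vector) manifold \<Rightarrow> 'p \<Rightarrow> ('p, 'e) tangent set" where
  "tangent_space M p =
     {v. (\<forall>c\<in>charts_at M p. \<forall>d\<in>charts_at M p.
            v d = frechet_derivative (snd d \<circ> chart_inv c) (at (snd c p)) (v c)) \<and>
         (\<forall>c. c \<notin> charts_at M p \<longrightarrow> v c = 0)}"

text \<open>The tangent vector at \<open>p\<close> whose components in the chart \<open>c\<close> are \<open>a\<close>.\<close>

definition coord_vec ::
    "('p, 'e::real_normed_vector) manifold \<Rightarrow> ('p, 'e) chart \<Rightarrow> 'p \<Rightarrow> 'e \<Rightarrow> ('p, 'e) tangent" where
  "coord_vec M c p a = (\<lambda>d. if d \<in> charts_at M p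
     then frechet_derivative (snd d \<circ> chart_inv c) (at (snd c p)) a else 0)"

text \<open>
  By the chain rule, the values of \<open>tangent_map\<close> and \<open>differential\<close> on tangent vectors do not depend
  on the choice of the chart \<open>chart_at M p\<close>.
\<close>

definition tangent_map ::
    "('p, 'e::real_normed_vector) manifold \<Rightarrow> ('q, 'f::real_normed_vector) manifold \<Rightarrow> ('p \<Rightarrow> 'q) \<Rightarrow>
     'p \<Rightarrow> ('p, 'e) tangent \<Rightarrow> ('q, 'f) tangent" where
  "tangent_map M N f p v = (let c = chart_at M p in
     (\<lambda>d. if d \<in> charts_at N (f p)
       then frechet_derivative (snd d \<circ> f \<circ> chart_inv c) (at (snd c p)) (v c) else 0))"

definition differential ::
    "('p, 'e::real_normed_vector) manifold \<Rightarrow> ('p \<Rightarrow> real) \<Rightarrow> 'p \<Rightarrow> ('p, 'e) tangent \<Rightarrow> real" where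
  "differential M h p v = (let c = chart_at M p in
     frechet_derivative (h \<circ> chart_inv c) (at (snd c p)) (v c))"

definition vector_field ::
    "('p, 'e::real_normed_vector) manifold \<Rightarrow> ('p \<Rightarrow> ('p, 'e) tangent) \<Rightarrow> bool" where
  "vector_field M X \<longleftrightarrow> (\<forall>p\<in>points M. X p \<in> tangent_space M p) \<and>
     (\<forall>c\<in>atlas M. smooth_on (snd c ` fst c) (\<lambda>x. X (chart_inv c x) c))"

definition smooth_embedding ::
    "('p, 'e::real_normed_vector) manifold \<Rightarrow> ('q, 'f::real_normed_vector) manifold \<Rightarrow> ('p \<Rightarrow> 'q) \<Rightarrow> bool"
  where
  "smooth_embedding M N f \<longleftrightarrow> smooth_map M N f \<and> embedding_map (mtop M) (mtop N) f \<and>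
     (\<forall>p\<in>points M. inj_on (tangent_map M N f p) (tangent_space M p))"


section \<open>Two-forms and symplectic manifolds\<close>

type_synonym ('p, 'e) form2 = "'p \<Rightarrow> ('p, 'e) tangent \<Rightarrow> ('p, 'e) tangent \<Rightarrow> real"

definition form_coeff ::
    "('p, 'e::real_normed_vector) manifold \<Rightarrow> ('p, 'e) form2 \<Rightarrow> ('p, 'e) chart \<Rightarrow> 'e \<Rightarrow> 'e \<Rightarrow> 'e \<Rightarrow> real" where
  "form_coeff M \<omega> c a b x =
     (let p = chart_inv c x in \<omega> p (coord_vec M c p a) (coord_vec M c p b))"

definition two_form :: "('p, 'e::real_normed_vector) manifold \<Rightarrow> ('p, 'e) form2 \<Rightarrow> bool" where
  "two_form M \<omega> \<longleftrightarrow>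
     (\<forall>p\<in>points M. \<forall>u\<in>tangent_space M p. \<forall>v\<in>tangent_space M p.
        \<omega> p u v = - \<omega> p v u \<and>
        (\<forall>w\<in>tangent_space M p. \<forall>r s. \<omega> p (\<lambda>c. r *\<^sub>R u c + s *\<^sub>R v c) w = r * \<omega> p u w + s * \<omega> p v w)) \<and>
     (\<forall>c\<in>atlas M. \<forall>a b. smooth_on (snd c ` fst c) (form_coeff M \<omega> c a b))"

text \<open>
  The exterior derivative, by the invariant formula for \<open>d\<omega>(U, V, W)\<close> with \<open>U\<close>, \<open>V\<close>, \<open>W\<close> the fields
  with constant components in a chart; their brackets vanish.
\<close>

definition exterior_derivative ::
    "('p, 'e::real_normed_vector) manifold \<Rightarrow> ('p, 'e) form2 \<Rightarrow>
     'p \<Rightarrow> ('p, 'e) tangent \<Rightarrow> ('p, 'e) tangent \<Rightarrow> ('p, 'e) tangent \<Rightarrow> real" where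
  "exterior_derivative M \<omega> p u v w = (let c = chart_at M p; x = snd c p in
       frechet_derivative (form_coeff M \<omega> c (v c) (w c)) (at x) (u c)
     - frechet_derivative (form_coeff M \<omega> c (u c) (w c)) (at x) (v c)
     + frechet_derivative (form_coeff M \<omega> c (u c) (v c)) (at x) (w c))"

definition closed_form :: "('p, 'e::real_normed_vector) manifold \<Rightarrow> ('p, 'e) form2 \<Rightarrow> bool" where
  "closed_form M \<omega> \<longleftrightarrow> (\<forall>p\<in>points M. \<forall>u\<in>tangent_space M p. \<forall>v\<in>tangent_space M p.
     \<forall>w\<in>tangent_space M p. exterior_derivative M \<omega> p u v w = 0)"

definition nondegenerate_form :: "('p, 'e::real_normed_vector) manifold \<Rightarrow> ('p, 'e) form2 \<Rightarrow> bool" where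
  "nondegenerate_form M \<omega> \<longleftrightarrow> (\<forall>p\<in>points M. \<forall>u\<in>tangent_space M p.
     (\<forall>v\<in>tangent_space M p. \<omega> p u v = 0) \<longrightarrow> u = (\<lambda>_. 0))"

definition symplectic_manifold :: "('p, 'e::real_normed_vector) manifold \<Rightarrow> ('p, 'e) form2 \<Rightarrow> bool" where
  "symplectic_manifold M \<omega> \<longleftrightarrow>
     smooth_manifold M \<and> two_form M \<omega> \<and> closed_form M \<omega> \<and> nondegenerate_form M \<omega>"

definition pullback2 ::
    "('p, 'e::real_normed_vector) manifold \<Rightarrow> ('q, 'f::real_normed_vector) manifold \<Rightarrow> ('p \<Rightarrow> 'q) \<Rightarrow>
     ('q, 'f) form2 \<Rightarrow> ('p, 'e) form2" where
  "pullback2 M N f \<omega> p u v = \<omega> (f p) (tangent_map M N f p u) (tangent_map M N f p v)"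


section \<open>Hamiltonian systems and the slicing equation\<close>

definition hamiltonian_vector_field ::
    "('p, 'e::real_normed_vector) manifold \<Rightarrow> ('p, 'e) form2 \<Rightarrow> ('p \<Rightarrow> real) \<Rightarrow>
     ('p \<Rightarrow> ('p, 'e) tangent) \<Rightarrow> bool" where
  "hamiltonian_vector_field P \<omega> H Z \<longleftrightarrow> vector_field P Z \<and>
     (\<forall>p\<in>points P. \<forall>v\<in>tangent_space P p. \<omega> p (Z p) v = differential P H p v)"

definition slicing_solution ::
    "('m, 'e::real_normed_vector) manifold \<Rightarrow> ('p, 'f::real_normed_vector) manifold \<Rightarrow>
     ('p \<Rightarrow> ('p, 'f) tangent) \<Rightarrow> ('m \<Rightarrow> 'p) \<Rightarrow> bool" where
  "slicing_solution M P Z \<alpha> \<longleftrightarrow>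
     (\<exists>X. vector_field M X \<and> (\<forall>m\<in>points M. tangent_map M P \<alpha> m (X m) = Z (\<alpha> m)))"

definition isotropic ::
    "('m, 'e::real_normed_vector) manifold \<Rightarrow> ('p, 'f::real_normed_vector) manifold \<Rightarrow>
     ('p, 'f) form2 \<Rightarrow> ('m \<Rightarrow> 'p) \<Rightarrow> bool" where
  "isotropic M P \<omega> \<alpha> \<longleftrightarrow> (\<forall>m\<in>points M. \<forall>u\<in>tangent_space M m. \<forall>v\<in>tangent_space M m.
     pullback2 M P \<alpha> \<omega> m u v = 0)"

definition lagrangian ::
    "('m, 'e::real_normed_vector) manifold \<Rightarrow> ('p, 'f::real_normed_vector) manifold \<Rightarrow>
     ('p, 'f) form2 \<Rightarrow> ('m \<Rightarrow> 'p) \<Rightarrow> bool" where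
  "lagrangian M P \<omega> \<alpha> \<longleftrightarrow> isotropic M P \<omega> \<alpha> \<and> mdim P = 2 * mdim M"

end

theory Submission
  imports Defs
begin

text \<open>
  By the chain rule and the definition of \<open>Z\<close>, \<open>d(H \<circ> \<alpha>)(v) = \<omega>(Z \<circ> \<alpha>, T\<alpha> v)\<close>. If
  \<open>Z \<circ> \<alpha> = T\<alpha> \<circ> X\<close> and \<open>\<alpha>\<close> is isotropic, the right-hand side vanishes. Conversely, if it vanishes,
  then \<open>Z\<close> is \<open>\<omega>\<close>-orthogonal to the image of \<open>T\<alpha>\<close>; in the Lagrangian case this image is a maximal
  isotropic subspace, so it contains \<open>Z\<close>, which gives \<open>X\<close> pointwise. In charts, \<open>X\<close> solves a linear
  system with smooth coefficients and injective matrix, and Gaussian elimination shows that \<open>X\<close> is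
  smooth.
\<close>

subsection \<open>Finite-dimensional normed spaces\<close>

text \<open>For \<open>r\<close> nonzero, divide by \<open>r\<close>: the vector
  \<open>- (1 / r) *\<^sub>R s\<close> is a point of \<open>V\<close>, so its distance to
  \<open>b\<close> is at least \<open>infdist b V\<close>. The bound controls the coefficient of
  \<open>b\<close> by the norm of the whole vector.\<close>

lemma norm_add_scaleR_ge_infdist:
  fixes b s :: "'a::real_normed_vector"
  assumes "subspace V" "s \<in> V"
  shows "\<bar>r\<bar> * infdist b V \<le> norm (r *\<^sub>R b + s)"
proof (cases "r = 0")
  case False
  have "- (1 / r) *\<^sub>R s \<in> V"
    using assms by (rule subspace_scale)
  then have "infdist b V \<le> dist b (- (1 / r) *\<^sub>R s)"
    by (rule infdist_le)
  also have "\<dots> = norm ((1 / r) *\<^sub>R (r *\<^sub>R b + s))"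
    using False by (simp add: dist_norm scaleR_add_right)
  also have "\<dots> = norm (r *\<^sub>R b + s) / \<bar>r\<bar>"
    by (simp only: norm_scaleR abs_divide) simp
  finally show ?thesis
    using False by (simp add: field_simps)
qed simp

lemma Cauchy_diff:
  fixes X Y :: "nat \<Rightarrow> 'a::real_normed_vector"
  assumes "Cauchy X" "Cauchy Y"
  shows "Cauchy (\<lambda>n. X n - Y n)"
proof (rule CauchyI)
  fix e :: real assume "e > 0"
  then have e: "e / 2 > 0" by simp
  from CauchyD[OF assms(1) e] obtain K
    where K: "\<And>m n. m \<ge> K \<Longrightarrow> n \<ge> K \<Longrightarrow> norm (X m - X n) < e / 2" by blast
  from CauchyD[OF assms(2) e] obtain L
    where L: "\<And>m n. m \<ge> L \<Longrightarrow> n \<ge> L \<Longrightarrow> norm (Y m - Y n) < e / 2" by blast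
  have "norm ((X m - Y m) - (X n - Y n)) < e" if "m \<ge> max K L" "n \<ge> max K L" for m n
  proof -
    have "norm ((X m - Y m) - (X n - Y n)) = norm ((X m - X n) - (Y m - Y n))"
      by (simp add: algebra_simps)
    also have "\<dots> \<le> norm (X m - X n) + norm (Y m - Y n)" by (rule norm_triangle_ineq4)
    also have "\<dots> < e" using K[of m n] L[of m n] that by simp
    finally show ?thesis .
  qed
  then show "\<exists>N. \<forall>m\<ge>N. \<forall>n\<ge>N. norm ((X m - Y m) - (X n - Y n)) < e" by blast
qed

text \<open>Induction on \<open>B\<close>. If \<open>b\<close> lies outside the complete, hence
  closed, span of the earlier vectors, it has positive distance from it. The
  \<open>b\<close>-coefficients of a Cauchy sequence are then Cauchy in the reals, and the
  remainders converge in the smaller span.\<close>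

lemma complete_span_finite:
  fixes B :: "'a::real_normed_vector set"
  assumes "finite B"
  shows "complete (span B)"
  using assms
proof (induction B)
  case empty
  show ?case by (simp add: compact_imp_complete)
next
  case (insert b B)
  show ?case
  proof (cases "b \<in> span B")
    case True
    then show ?thesis using insert.IH by (simp add: span_redundant)
  next
    case False
    define \<delta> where "\<delta> = infdist b (span B)"
    have "closed (span B)" using insert.IH by (rule complete_imp_closed)
    moreover have "span B \<noteq> {}" using span_zero by blast
    ultimately have \<delta>: "\<delta> > 0"
      using False unfolding \<delta>_def
      by (metis in_closed_iff_infdist_zero infdist_nonneg less_eq_real_def)
    show ?thesis
    proof (rule completeI)
      fix \<sigma> assume \<sigma>: "\<forall>n::nat. \<sigma> n \<in> span (insert b B)" and cauchy: "Cauchy \<sigma>"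
      from \<sigma> have "\<forall>n. \<exists>r. \<sigma> n - r *\<^sub>R b \<in> span B" by (simp add: span_insert)
      then obtain r where r: "\<And>n. \<sigma> n - r n *\<^sub>R b \<in> span B" by metis
      \<comment> \<open>The difference of two terms is \<open>(r m - r n) *\<^sub>R b\<close> plus
        an element of \<open>span B\<close>, so the distance estimate applies.\<close>
      have bound: "\<bar>r m - r n\<bar> * \<delta> \<le> norm (\<sigma> m - \<sigma> n)" for m n
      proof -
        have "(\<sigma> m - r m *\<^sub>R b) - (\<sigma> n - r n *\<^sub>R b) \<in> span B" using r[of m] r[of n] by (rule span_diff)
        from norm_add_scaleR_ge_infdist[OF subspace_span this, of "r m - r n" b]
        show ?thesis by (simp add: \<delta>_def algebra_simps)
      qed
      have "Cauchy r"
      proof (rule CauchyI)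
        fix e :: real assume "e > 0"
        then have "e * \<delta> > 0" using \<delta> by simp
        from CauchyD[OF cauchy this] obtain N
          where N: "\<And>m n. m \<ge> N \<Longrightarrow> n \<ge> N \<Longrightarrow> norm (\<sigma> m - \<sigma> n) < e * \<delta>" by blast
        have "norm (r m - r n) < e" if "m \<ge> N" "n \<ge> N" for m n
        proof -
          have "\<bar>r m - r n\<bar> * \<delta> < e * \<delta>"
            using bound N[OF that] by (rule le_less_trans)
          then show ?thesis using \<delta> by simp
        qed
        then show "\<exists>N. \<forall>m\<ge>N. \<forall>n\<ge>N. norm (r m - r n) < e" by blast
      qed
      then obtain R where R: "r \<longlonglongrightarrow> R"
        using Cauchy_convergent convergent_def by blast
      then have "Cauchy (\<lambda>n. r n *\<^sub>R b)"
        using LIMSEQ_imp_Cauchy[OF tendsto_scaleR[OF _ tendsto_const]] by blast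
      then have "Cauchy (\<lambda>n. \<sigma> n - r n *\<^sub>R b)" using cauchy by (intro Cauchy_diff)
      then obtain s where s: "s \<in> span B" "(\<lambda>n. \<sigma> n - r n *\<^sub>R b) \<longlonglongrightarrow> s"
        by (rule completeE[OF insert.IH allI[OF r]])
      have "(\<lambda>n. r n *\<^sub>R b + (\<sigma> n - r n *\<^sub>R b)) \<longlonglongrightarrow> R *\<^sub>R b + s"
        by (intro tendsto_intros R s)
      moreover have "R *\<^sub>R b + s \<in> span (insert b B)"
        by (intro span_add span_scale) (use s(1) span_mono[of B "insert b B"] in \<open>auto intro: span_base\<close>)
      ultimately show "\<exists>l\<in>span (insert b B). \<sigma> \<longlonglongrightarrow> l" by auto
    qed
  qed
qed

text \<open>The span of the other basis vectors is closed and misses \<open>b\<close>, so it has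
  positive distance from \<open>b\<close>; the reciprocal of this distance bounds the coordinate
  functional.\<close>

lemma bounded_linear_representation:
  fixes B :: "'a::real_normed_vector set"
  assumes fin: "finite B" and ind: "independent B" and span: "span B = UNIV" and b: "b \<in> B"
  shows "bounded_linear (\<lambda>u. representation B u b)"
proof -
  let ?V = "span (B - {b})"
  have "b \<notin> ?V" using ind b by (simp add: dependent_def)
  moreover have "closed ?V" using fin by (intro complete_imp_closed complete_span_finite) auto
  moreover have "?V \<noteq> {}" using span_zero by blast
  ultimately have \<delta>: "infdist b ?V > 0"
    by (metis in_closed_iff_infdist_zero infdist_nonneg less_eq_real_def)
  show ?thesis
  proof (rule bounded_linear_intro)
    fix u v :: 'a and r :: real
    show "representation B (u + v) b = representation B u b + representation B v b"
      using ind span by (simp add: representation_add)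
    show "representation B (r *\<^sub>R u) b = r *\<^sub>R representation B u b"
      using ind span by (simp add: representation_scale)
    have "u = (\<Sum>c\<in>B. representation B u c *\<^sub>R c)"
      using ind span fin by (simp add: sum_representation_eq)
    also have "\<dots> = representation B u b *\<^sub>R b + (\<Sum>c\<in>B - {b}. representation B u c *\<^sub>R c)"
      using fin b by (rule sum.remove)
    finally have u: "representation B u b *\<^sub>R b + (\<Sum>c\<in>B - {b}. representation B u c *\<^sub>R c) = u" ..
    have "(\<Sum>c\<in>B - {b}. representation B u c *\<^sub>R c) \<in> ?V"
      by (intro span_sum span_scale span_base)
    from norm_add_scaleR_ge_infdist[OF subspace_span this, of "representation B u b" b]
    show "norm (representation B u b) \<le> norm u * (1 / infdist b ?V)"
      using \<delta> by (simp add: u field_simps)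
  qed
qed

text \<open>Extend \<open>v\<close> to a basis, which is finite by the spanning set
  \<open>B\<close>, and take the coordinate of \<open>v\<close>. This supplies the pivots of the
  elimination.\<close>

lemma separating_functional:
  fixes v :: "'a::real_normed_vector"
  assumes "finite B" "span B = (UNIV :: 'a set)" "v \<noteq> 0"
  obtains \<phi> :: "'a \<Rightarrow> real" where "bounded_linear \<phi>" "\<phi> v \<noteq> 0"
proof -
  have "independent {v}" using assms by simp
  then obtain D where D: "{v} \<subseteq> D" "independent D" "UNIV \<subseteq> span D"
    by (rule maximal_independent_subset_extend[OF subset_UNIV])
  moreover have "finite D"
    using independent_span_bound[OF assms(1) D(2)] assms(2) by auto
  ultimately have "bounded_linear (\<lambda>u. representation D u v)"
    by (intro bounded_linear_representation) auto
  moreover have "representation D v v \<noteq> 0"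
    using D by (simp add: representation_basis)
  ultimately show thesis by (rule that)
qed

subsection \<open>Calculus of smooth maps\<close>

lemma Ck_on_mono: "Ck_on k S f \<Longrightarrow> T \<subseteq> S \<Longrightarrow> Ck_on k T f"
  by (induction k arbitrary: f) (auto intro: continuous_on_subset)

text \<open>Derivatives are taken \<open>at x\<close> in the whole space; openness of
  \<open>S\<close> makes agreement on \<open>S\<close> enough for them to coincide.\<close>

lemma Ck_on_cong:
  assumes "open S" "Ck_on k S f" "\<And>x. x \<in> S \<Longrightarrow> f x = g x"
  shows "Ck_on k S g"
  using assms(2,3)
proof (induction k arbitrary: f g)
  case 0
  then show ?case by (simp cong: continuous_on_cong)
next
  case (Suc k)
  have eq: "frechet_derivative f (at x) = frechet_derivative g (at x)" if "x \<in> S" for x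
    using Suc.prems that by (intro frechet_derivative_transform_within_open[OF _ assms(1)]) auto
  have "g differentiable at x" if x: "x \<in> S" for x
  proof -
    obtain f' where "(f has_derivative f') (at x)"
      using Suc.prems(1) x by (auto simp: differentiable_def)
    then have "(g has_derivative f') (at x)"
      using assms(1) x Suc.prems(2) by (rule has_derivative_transform_within_open)
    then show ?thesis by (auto simp: differentiable_def)
  qed
  moreover have "Ck_on k S (\<lambda>x. frechet_derivative g (at x) a)" for a
    by (rule Suc.IH[of "\<lambda>x. frechet_derivative f (at x) a"]) (use Suc.prems(1) eq in auto)
  ultimately show ?case by simp
qed

text \<open>Replaces \<open>frechet_derivative\<close> by an explicit derivative formula; the
  product, inverse and chain rules below feed their formulas into it.\<close>

lemma Ck_on_SucI:
  assumes "open S" and "\<And>x. x \<in> S \<Longrightarrow> (f has_derivative f' x) (at x)"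
    and "\<And>a. Ck_on k S (\<lambda>x. f' x a)"
  shows "Ck_on (Suc k) S f"
proof -
  have "Ck_on k S (\<lambda>x. frechet_derivative f (at x) a)" for a
    using assms(2) by (intro Ck_on_cong[OF assms(1) assms(3)[of a]]) (metis frechet_derivative_at)
  then show ?thesis
    using assms(2) by (auto simp: differentiable_def)
qed

lemma Ck_on_SucD:
  assumes "Ck_on (Suc k) S f"
  shows "x \<in> S \<Longrightarrow> (f has_derivative frechet_derivative f (at x)) (at x)"
    and "Ck_on k S (\<lambda>x. frechet_derivative f (at x) a)"
  using assms by (auto simp: frechet_derivative_works[symmetric])

lemma Ck_on_continuous: "Ck_on k S f \<Longrightarrow> continuous_on S f"
  by (cases k) (auto intro!: continuous_at_imp_continuous_on differentiable_imp_continuous_within)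

text \<open>The base case is that differentiability implies continuity. Needed because the product
  rule contains undifferentiated factors.\<close>

lemma Ck_on_pred: "Ck_on (Suc k) S f \<Longrightarrow> Ck_on k S f"
proof (induction k arbitrary: f)
  case 0
  then show ?case using Ck_on_continuous by (metis Ck_on.simps(1))
next
  case (Suc k)
  have "f differentiable at x" if "x \<in> S" for x using Suc.prems that by simp
  moreover have "Ck_on k S (\<lambda>x. frechet_derivative f (at x) a)" for a
    by (rule Suc.IH, rule Ck_on_SucD(2), rule Suc.prems)
  ultimately show ?case by simp
qed

text \<open>Allows the domain to be shrunk around each point, both to keep a pivot nonzero and to
  stay inside one chart of the target manifold.\<close>

lemma Ck_on_local:
  assumes "\<And>x. x \<in> S \<Longrightarrow> \<exists>U. open U \<and> x \<in> U \<and> Ck_on k U f"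
  shows "Ck_on k S f"
  using assms
proof (induction k arbitrary: f)
  case 0
  have "isCont f x" if "x \<in> S" for x
    using 0[OF that] by (auto simp: continuous_on_eq_continuous_at)
  then show ?case by (simp add: continuous_at_imp_continuous_on)
next
  case (Suc k)
  have "f differentiable at x" if "x \<in> S" for x
    using Suc.prems[OF that] by auto
  moreover have "Ck_on k S (\<lambda>x. frechet_derivative f (at x) a)" for a
    using Suc.prems by (intro Suc.IH) (metis Ck_on_SucD(2))
  ultimately show ?case by simp
qed

section \<open>Constants, sums, products, inverses and composites\<close>

lemma Ck_on_const: "Ck_on k S (\<lambda>_. c)"
proof (induction k arbitrary: c)
  case (Suc k)
  then show ?case by simp
qed simp

lemma Ck_on_bounded_linear:
  assumes "bounded_linear L" "open S" "Ck_on k S f"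
  shows "Ck_on k S (\<lambda>x. L (f x))"
  using assms(3)
proof (induction k arbitrary: f)
  case 0
  then show ?case
    using assms(1) by (simp add: bounded_linear.continuous_on)
next
  case (Suc k)
  show ?case
    by (rule Ck_on_SucI[OF assms(2)
          bounded_linear.has_derivative[OF assms(1) Ck_on_SucD(1)[OF Suc.prems]]])
      (auto intro!: Suc.IH Ck_on_SucD(2)[OF Suc.prems] assms(2))
qed

lemma Ck_on_add:
  assumes "open S" "Ck_on k S f" "Ck_on k S g"
  shows "Ck_on k S (\<lambda>x. f x + g x)"
  using assms(2,3)
proof (induction k arbitrary: f g)
  case 0
  then show ?case by (simp add: continuous_on_add)
next
  case (Suc k)
  show ?case
    by (rule Ck_on_SucI[OF assms(1)
          has_derivative_add[OF Ck_on_SucD(1)[OF Suc.prems(1)] Ck_on_SucD(1)[OF Suc.prems(2)]]])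
      (auto intro!: Suc.IH Ck_on_SucD(2) Suc.prems assms(1) simp del: Ck_on.simps)
qed

lemma Ck_on_sum:
  assumes "open S" "\<And>i. i \<in> I \<Longrightarrow> Ck_on k S (f i)"
  shows "Ck_on k S (\<lambda>x. \<Sum>i\<in>I. f i x)"
  using assms(2)
  by (induction I rule: infinite_finite_induct) (auto intro!: Ck_on_const Ck_on_add assms(1))

lemma Ck_on_scaleR:
  fixes f :: "'a::real_normed_vector \<Rightarrow> real"
  assumes "open S" "Ck_on k S f" "Ck_on k S g"
  shows "Ck_on k S (\<lambda>x. f x *\<^sub>R g x)"
  using assms(2,3)
proof (induction k arbitrary: f g)
  case 0
  then show ?case by (simp add: continuous_on_scaleR)
next
  case (Suc k)
  show ?case
    by (rule Ck_on_SucI[OF assms(1)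
          has_derivative_scaleR[OF Ck_on_SucD(1)[OF Suc.prems(1)] Ck_on_SucD(1)[OF Suc.prems(2)]]],
        assumption, assumption, intro Ck_on_add assms(1) Suc.IH Ck_on_SucD(2)[OF Suc.prems(1)]
        Ck_on_SucD(2)[OF Suc.prems(2)] Ck_on_pred[OF Suc.prems(1)] Ck_on_pred[OF Suc.prems(2)])
qed

text \<open>The derivative of 1/f is -(1/f) f' (1/f). It involves 1/f only to order
  \<open>k\<close>, which the induction hypothesis provides.\<close>

lemma Ck_on_inverse:
  fixes f :: "'a::real_normed_vector \<Rightarrow> real"
  assumes "open S" "Ck_on k S f" "\<And>x. x \<in> S \<Longrightarrow> f x \<noteq> 0"
  shows "Ck_on k S (\<lambda>x. inverse (f x))"
  using assms(2)
proof (induction k)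
  case 0
  then show ?case using assms(3) by (simp add: continuous_on_inverse)
next
  case (Suc k)
  have inv: "Ck_on k S (\<lambda>x. inverse (f x))" by (rule Suc.IH[OF Ck_on_pred[OF Suc.prems]])
  have "Ck_on k S (\<lambda>x. (- 1) *\<^sub>R (inverse (f x) *\<^sub>R frechet_derivative f (at x) a *\<^sub>R inverse (f x)))" for a
    by (intro Ck_on_scaleR Ck_on_const inv Ck_on_SucD(2)[OF Suc.prems] assms(1))
  then show ?case
    by (intro Ck_on_SucI[OF assms(1)
          Deriv.has_derivative_inverse[OF assms(3) Ck_on_SucD(1)[OF Suc.prems]]])
      (auto simp: mult.assoc)
qed

text \<open>In the chain rule the direction in which \<open>g\<close> is differentiated varies with
  \<open>x\<close>, while \<open>Ck_on\<close> speaks of fixed directions. Expanding this direction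
  in the basis \<open>B\<close> gives a finite sum of coordinates of Df times composites of fixed
  directional derivatives of \<open>g\<close> with \<open>f\<close>, and the induction hypothesis
  covers those composites.\<close>

lemma Ck_on_compose:
  fixes f :: "'a::real_normed_vector \<Rightarrow> 'b::real_normed_vector"
    and g :: "'b \<Rightarrow> 'c::real_normed_vector"
  assumes B: "finite B" "independent B" "span B = (UNIV :: 'b set)" and "open S"
    and "Ck_on k S f" "Ck_on k T g" "f ` S \<subseteq> T"
  shows "Ck_on k S (g \<circ> f)"
  using assms(5,6)
proof (induction k arbitrary: g)
  case 0
  then show ?case
    using assms(7) continuous_on_compose[of S f g] continuous_on_subset[of T g "f ` S"] by simp
next
  case (Suc k)
  let ?r = "\<lambda>b x a. representation B (frechet_derivative f (at x) a) b"
  have g': "(g has_derivative frechet_derivative g (at (f x))) (at (f x))" if "x \<in> S" for x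
    using Suc.prems(2) that assms(7) by (intro Ck_on_SucD(1)) auto
  have "Ck_on k S (\<lambda>x. \<Sum>b\<in>B. ?r b x a *\<^sub>R ((\<lambda>y. frechet_derivative g (at y) b) \<circ> f) x)" for a
    by (intro Ck_on_sum Ck_on_scaleR assms(4) Suc.IH Ck_on_pred[OF Suc.prems(1)]
        Ck_on_SucD(2)[OF Suc.prems(2)] Ck_on_bounded_linear[OF bounded_linear_representation[OF B]]
        Ck_on_SucD(2)[OF Suc.prems(1)])
  moreover have "(\<Sum>b\<in>B. ?r b x a *\<^sub>R ((\<lambda>y. frechet_derivative g (at y) b) \<circ> f) x)
      = (frechet_derivative g (at (f x)) \<circ> frechet_derivative f (at x)) a" if "x \<in> S" for x a
  proof -
    have "linear (frechet_derivative g (at (f x)))"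
      using g'[OF that] by (rule has_derivative_linear)
    then have "(\<Sum>b\<in>B. ?r b x a *\<^sub>R frechet_derivative g (at (f x)) b)
        = frechet_derivative g (at (f x)) (\<Sum>b\<in>B. ?r b x a *\<^sub>R b)"
      by (simp add: linear_sum linear_scale)
    also have "(\<Sum>b\<in>B. ?r b x a *\<^sub>R b) = frechet_derivative f (at x) a"
      using B by (simp add: sum_representation_eq)
    finally show ?thesis by simp
  qed
  ultimately have "Ck_on k S (\<lambda>x. (frechet_derivative g (at (f x)) \<circ> frechet_derivative f (at x)) a)" for a
    by (rule Ck_on_cong[OF assms(4)])
  then show ?case
    by (intro Ck_on_SucI[OF assms(4)
          diff_chain_at[OF Ck_on_SucD(1)[OF Suc.prems(1)] g']])
      (auto)
qed

lemma Ck_on_diff: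
  assumes "open S" "Ck_on k S f" "Ck_on k S g"
  shows "Ck_on k S (\<lambda>x. f x - g x)"
proof -
  have "Ck_on k S (\<lambda>x. f x + (- 1) *\<^sub>R g x)"
    by (intro Ck_on_add Ck_on_scaleR Ck_on_const assms)
  then show ?thesis by simp
qed

lemma Ck_on_divide:
  fixes f g :: "'a::real_normed_vector \<Rightarrow> real"
  assumes "open S" "Ck_on k S f" "Ck_on k S g" "\<And>x. x \<in> S \<Longrightarrow> g x \<noteq> 0"
  shows "Ck_on k S (\<lambda>x. f x / g x)"
proof -
  have "Ck_on k S (\<lambda>x. f x *\<^sub>R inverse (g x))"
    by (intro Ck_on_scaleR Ck_on_inverse assms)
  then show ?thesis by (simp add: divide_inverse)
qed

text \<open>
  Gaussian elimination: near a given point one field is removed by means of a linear functional that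
  does not vanish on it.
\<close>

lemma Ck_on_coefficients:
  fixes F :: "'i \<Rightarrow> 'a::real_normed_vector \<Rightarrow> 'b::real_normed_vector"
  assumes B: "finite B" "span B = (UNIV :: 'b set)" and "finite I"
    and "open S" "\<And>i. i \<in> I \<Longrightarrow> Ck_on k S (F i)" "Ck_on k S z"
    and "\<And>x. x \<in> S \<Longrightarrow> (\<Sum>i\<in>I. r i x *\<^sub>R F i x) = z x"
    and "\<And>x t i. x \<in> S \<Longrightarrow> (\<Sum>i\<in>I. t i *\<^sub>R F i x) = 0 \<Longrightarrow> i \<in> I \<Longrightarrow> t i = 0"
    and "i \<in> I"
  shows "Ck_on k S (r i)"
  using assms(3-)
proof (induction I arbitrary: F z S i rule: finite_induct)
  case (insert j I)
  note F = insert.prems(2) and eq = insert.prems(4) and indep = insert.prems(5)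
  show ?case
  proof (rule Ck_on_local)
    fix x0 assume x0: "x0 \<in> S"
    have "F j x0 \<noteq> 0"
    proof
      assume "F j x0 = 0"
      \<comment> \<open>If \<open>F j x0\<close> were zero, the unit coefficient at \<open>j\<close>
        would be a nontrivial relation.\<close>
      then have "(\<Sum>i\<in>insert j I. (if i = j then 1 else 0) *\<^sub>R F i x0) = 0"
        by (intro sum.neutral) auto
      from indep[OF x0 this, of j] show False by simp
    qed
    \<comment> \<open>\<phi> selects the pivot: \<open>\<phi> (F j x)\<close> is nonzero at
      \<open>x0\<close>, hence on the neighbourhood \<open>U\<close> defined next.\<close>
    with B obtain \<phi> :: "'b \<Rightarrow> real" where \<phi>: "bounded_linear \<phi>" "\<phi> (F j x0) \<noteq> 0"
      by (rule separating_functional)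
    interpret \<phi>: bounded_linear \<phi> by fact
    define U where "U = {x \<in> S. \<phi> (F j x) \<noteq> 0}"
    have "continuous_on S (\<lambda>x. \<phi> (F j x))"
      by (rule \<phi>.continuous_on, rule Ck_on_continuous, rule F) simp
    then have "open (S \<inter> (\<lambda>x. \<phi> (F j x)) -` (- {0}))"
      using insert.prems(1) by (intro continuous_open_preimage) auto
    also have "S \<inter> (\<lambda>x. \<phi> (F j x)) -` (- {0}) = U" by (auto simp: U_def)
    finally have U: "open U" .
    have US: "U \<subseteq> S" and nz: "\<And>x. x \<in> U \<Longrightarrow> \<phi> (F j x) \<noteq> 0" by (auto simp: U_def)
    note smooth = Ck_on_scaleR[OF U] Ck_on_divide[OF U _ _ nz] Ck_on_diff[OF U]
      Ck_on_bounded_linear[OF \<phi>(1) U] Ck_on_mono[OF F US] Ck_on_mono[OF insert.prems(3) US]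
    \<comment> \<open>On \<open>U\<close>, \<open>q v x\<close> is the multiple of
      \<open>F j x\<close> to subtract from \<open>v\<close> in order to land in the kernel of
      \<phi>.\<close>
    define q where "q v x = \<phi> v / \<phi> (F j x)" for v x
    have q: "Ck_on k U (\<lambda>x. q (G x) x)" if "Ck_on k U G" for G
      unfolding q_def by (intro smooth that) simp_all
    have q_sum: "(\<Sum>i\<in>I. t i *\<^sub>R (F i x - q (F i x) x *\<^sub>R F j x))
        = (\<Sum>i\<in>I. t i *\<^sub>R F i x) - q (\<Sum>i\<in>I. t i *\<^sub>R F i x) x *\<^sub>R F j x" for t x
      by (simp add: q_def \<phi>.sum \<phi>.scale scaleR_diff_right sum_subtractf sum_divide_distrib
          scaleR_sum_left)
    \<comment> \<open>The reduced fields and reduced right-hand side keep the same coefficients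
      \<open>r i\<close> for \<open>i\<close> in \<open>I\<close>; only the unknown
      \<open>r j\<close> drops out.\<close>
    have rI: "Ck_on k U (r i)" if "i \<in> I" for i
    proof (rule insert.IH[where F = "\<lambda>i x. F i x - q (F i x) x *\<^sub>R F j x"
          and z = "\<lambda>x. z x - q (z x) x *\<^sub>R F j x"])
      show "Ck_on k U (\<lambda>x. F i x - q (F i x) x *\<^sub>R F j x)" if "i \<in> I" for i
        using that by (intro smooth q) auto
      show "Ck_on k U (\<lambda>x. z x - q (z x) x *\<^sub>R F j x)"
        by (intro smooth q) auto
      show "(\<Sum>i\<in>I. r i x *\<^sub>R (F i x - q (F i x) x *\<^sub>R F j x)) = z x - q (z x) x *\<^sub>R F j x"
        if "x \<in> U" for x
      proof -
        have z: "z x = r j x *\<^sub>R F j x + (\<Sum>i\<in>I. r i x *\<^sub>R F i x)"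
          using eq[of x] that US insert.hyps by auto
        show ?thesis
          unfolding q_sum z using nz[OF that]
          by (simp add: q_def \<phi>.add \<phi>.scale add_divide_distrib scaleR_add_left)
      qed
      show "t i = 0" if "x \<in> U" "(\<Sum>i\<in>I. t i *\<^sub>R (F i x - q (F i x) x *\<^sub>R F j x)) = 0" "i \<in> I"
        for x t i
      proof -
        let ?s = "\<Sum>i\<in>I. t i *\<^sub>R F i x"
        \<comment> \<open>A relation among the reduced fields is one among the original fields once
          \<open>F j\<close> receives the total of the subtracted multiples.\<close>
        let ?t = "\<lambda>i. if i = j then - q ?s x else t i"
        have "(\<Sum>i\<in>I. ?t i *\<^sub>R F i x) = ?s"
          using insert.hyps by (intro sum.cong) auto
        then have "(\<Sum>i\<in>insert j I. ?t i *\<^sub>R F i x) = 0"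
          using insert.hyps that(2) unfolding q_sum by simp
        with that US have "?t i = 0" by (intro indep[of x ?t i]) auto
        moreover have "i \<noteq> j" using that(3) insert.hyps by blast
        ultimately show ?thesis by simp
      qed
    qed (use U that in auto)
    \<comment> \<open>Back substitution: what remains of \<open>z x\<close> after the other terms is
      \<open>r j x *\<^sub>R F j x\<close>, from which \<open>q\<close> reads off
      \<open>r j x\<close>.\<close>
    have "Ck_on k U (r j)"
    proof -
      have "Ck_on k U (\<lambda>x. q (z x - (\<Sum>i\<in>I. r i x *\<^sub>R F i x)) x)"
        by (intro q smooth Ck_on_sum U rI) auto
      moreover have "q (z x - (\<Sum>i\<in>I. r i x *\<^sub>R F i x)) x = r j x" if "x \<in> U" for x
      proof -
        have "z x - (\<Sum>i\<in>I. r i x *\<^sub>R F i x) = r j x *\<^sub>R F j x"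
          using eq[of x] that US insert.hyps by (auto simp: algebra_simps)
        then show ?thesis using nz[OF that] by (simp add: q_def \<phi>.scale)
      qed
      ultimately show ?thesis by (rule Ck_on_cong[OF U])
    qed
    with rI have "Ck_on k U (r i)" using insert.prems(6) by auto
    moreover have "x0 \<in> U" using x0 \<phi>(2) by (simp add: U_def)
    ultimately show "\<exists>U. open U \<and> x0 \<in> U \<and> Ck_on k U (r i)" using U by blast
  qed
qed simp

subsection \<open>Isotropic subspaces\<close>

text \<open>Induction on the equations: either \<open>f c\<close> vanishes on \<open>B\<close> and
  imposes nothing, or its kernel in \<open>span B\<close> loses at most one dimension, so there are
  still more unknowns than equations.\<close>

lemma underdetermined_system:
  fixes f :: "'c \<Rightarrow> 'b::real_vector \<Rightarrow> real"
  assumes "finite C" and "finite B" "independent B" "card C < card B"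
    and "\<And>c. c \<in> C \<Longrightarrow> linear (f c)"
  obtains u where "u \<in> span B" "u \<noteq> 0" "\<And>c. c \<in> C \<Longrightarrow> f c u = 0"
proof -
  have "\<exists>u\<in>span B. u \<noteq> 0 \<and> (\<forall>c\<in>C. f c u = 0)"
    using assms
  proof (induction C arbitrary: B rule: finite_induct)
    case empty
    then obtain b where "b \<in> B" by fastforce
    with empty.prems(2) show ?case by (metis dependent_zero empty_iff span_base)
  next
    case (insert c C)
    show ?case
    proof (cases "\<forall>b\<in>B. f c b = 0")
      case True
      obtain u where u: "u \<in> span B" "u \<noteq> 0" "\<forall>c\<in>C. f c u = 0"
        using insert.IH[of B] insert.prems insert.hyps by auto
      moreover have "f c u = 0"
        using True u(1) insert.prems(4) by (intro linear_eq_0_on_span[of "f c" B u]) auto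
      ultimately show ?thesis by blast
    next
      case False
      then obtain b where b: "b \<in> B" "f c b \<noteq> 0" by blast
      have lin: "linear (f c)" using insert.prems(4) by simp
      \<comment> \<open>\<open>D\<close> is a basis of the kernel of \<open>f c\<close> in
        \<open>span B\<close>.\<close>
      obtain D where D: "D \<subseteq> {u \<in> span B. f c u = 0}" "independent D"
        "{u \<in> span B. f c u = 0} \<subseteq> span D"
        by (rule maximal_independent_subset)
      have finD: "finite D"
        using independent_span_bound[OF insert.prems(1) D(2)] D(1) by auto
      have "v \<in> span (insert b D)" if "v \<in> B" for v
      proof -
        \<comment> \<open>Subtracting this multiple of \<open>b\<close> moves \<open>v\<close> into
          the kernel; hence \<open>insert b D\<close> spans \<open>B\<close>, and \<open>D\<close>
          has at least \<open>card B - 1\<close> elements.\<close>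
        have "v - (f c v / f c b) *\<^sub>R b \<in> span D"
          using that b D(3)
          by (intro subsetD[OF D(3)]) (simp add: linear_diff[OF lin] linear_scale[OF lin]
              span_base span_diff span_scale)
        then show ?thesis unfolding span_insert by blast
      qed
      then have "card B \<le> card (insert b D)"
        using independent_span_bound[OF _ insert.prems(2)] finD by blast
      also have "\<dots> \<le> Suc (card D)" by (rule card_insert_le_m1) simp_all
      finally have "card C < card D" using insert.prems(3) insert.hyps by simp
      then obtain u where u: "u \<in> span D" "u \<noteq> 0" "\<forall>c\<in>C. f c u = 0"
        using insert.IH[OF finD D(2)] insert.prems(4) by auto
      have "span D \<subseteq> span B"
        using D(1) by (intro span_minimal) auto
      moreover have "f c u = 0"
        using D(1) u(1) lin by (intro linear_eq_0_on_span[of "f c" D u]) auto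
      ultimately show ?thesis using u by blast
    qed
  qed
  then show thesis using that by blast
qed

text \<open>Let n be \<open>card B\<close>. If \<open>z\<close> were outside \<open>span B\<close>,
  adjoining it would give an isotropic subspace of dimension n + 1 in dimension 2n. Only n - 1
  further basis vectors remain, so some nonzero \<open>u\<close> in the subspace is orthogonal to
  all of them and, by isotropy, to everything. This contradicts nondegeneracy.\<close>

lemma lagrangian_subspace_maximal:
  fixes \<omega> :: "'b::real_vector \<Rightarrow> 'b \<Rightarrow> real"
  assumes lin: "\<And>v. linear (\<lambda>u. \<omega> u v)" and alt: "\<And>u v. \<omega> u v = - \<omega> v u"
    and nondeg: "\<And>u. (\<And>v. \<omega> u v = 0) \<Longrightarrow> u = 0"
    and "finite D" "span D = (UNIV :: 'b set)"
    and B: "finite B" "independent B" "dim (UNIV :: 'b set) = 2 * card B"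
    and iso: "\<And>u v. u \<in> B \<Longrightarrow> v \<in> B \<Longrightarrow> \<omega> u v = 0"
    and z: "\<And>v. v \<in> B \<Longrightarrow> \<omega> z v = 0"
  shows "z \<in> span B"
proof (rule ccontr)
  assume "z \<notin> span B"
  define W where "W = insert z B"
  have "z \<notin> B" using \<open>z \<notin> span B\<close> span_base by blast
  then have W: "finite W" "independent W" "card W = Suc (card B)"
    using B \<open>z \<notin> span B\<close> by (auto simp: W_def independent_insertI)
  have lin2: "linear (\<omega> u)" for u
  proof -
    have "linear (\<lambda>v. - \<omega> v u)" by (rule linear_compose_neg[OF lin])
    moreover have "(\<lambda>v. - \<omega> v u) = \<omega> u" by (rule ext) (rule alt[symmetric])
    ultimately show ?thesis by simp
  qed
  \<comment> \<open>For \<open>u = v = z\<close>, skew symmetry gives \<omega>(z,z) =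
    -\<omega>(z,z), hence zero.\<close>
  have isoW: "\<omega> u v = 0" if "u \<in> W" "v \<in> W" for u v
    using that iso z alt[of u v] alt[of z z] by (auto simp: W_def)
  obtain E where E: "W \<subseteq> E" "independent E" "UNIV \<subseteq> span E"
    using W(2) by (rule maximal_independent_subset_extend[OF subset_UNIV])
  have "finite E" using independent_span_bound[OF assms(4) E(2)] assms(5) by auto
  have "card E = 2 * card B" using basis_card_eq_dim[of E UNIV] E B by simp
  then have "card (E - W) < card W"
    using E W card_mono[OF \<open>finite E\<close> E(1)] by (simp add: card_Diff_subset)
  then obtain u where u: "u \<in> span W" "u \<noteq> 0" "\<And>e. e \<in> E - W \<Longrightarrow> \<omega> u e = 0"
    using underdetermined_system[of "E - W" W "\<lambda>e u. \<omega> u e"] \<open>finite E\<close> W lin by auto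
  have "\<omega> u e = 0" if "e \<in> W" for e
    using isoW[OF _ that] u(1) by (rule linear_eq_0_on_span[OF lin])
  then have "\<omega> u e = 0" if "e \<in> E" for e using u(3) that by blast
  then have "\<omega> u v = 0" for v
    by (rule linear_eq_0_on_span[OF lin2]) (use E(3) in auto)
  with nondeg u(2) show False by blast
qed

subsection \<open>Charts\<close>

text \<open>A chart is a homeomorphism onto an open set, so sets open relative to its image are open
  in the model space.\<close>

lemma
  assumes "is_chart T c"
  shows chart_openin: "openin T (fst c)"
    and inj_on_chart: "inj_on (snd c) (fst c)"
    and open_chart_image: "openin T U \<Longrightarrow> U \<subseteq> fst c \<Longrightarrow> open (snd c ` U)"
proof -
  have hom: "homeomorphic_map (subtopology T (fst c)) (top_of_set (snd c ` fst c)) (snd c)"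
    and open_image: "open (snd c ` fst c)"
    using assms by (auto simp: is_chart_def)
  show openin: "openin T (fst c)" using assms by (simp add: is_chart_def)
  then have "topspace (subtopology T (fst c)) = fst c"
    by (simp add: openin_subset Int_absorb1)
  then show "inj_on (snd c) (fst c)"
    using homeomorphic_imp_injective_map[OF hom] by simp
  show "open (snd c ` U)" if U: "openin T U" "U \<subseteq> fst c"
  proof -
    have "openin (subtopology T (fst c)) U"
      using U openin by (simp add: openin_open_subtopology)
    then have "openin (top_of_set (snd c ` fst c)) (snd c ` U)"
      using homeomorphic_imp_open_map[OF hom] by (simp add: open_map_def)
    then show ?thesis using open_image by (simp add: openin_open_eq)
  qed
qed

lemma chart_inv_eq: "is_chart T c \<Longrightarrow> p \<in> fst c \<Longrightarrow> chart_inv c (snd c p) = p"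
  by (simp add: chart_inv_def inj_on_chart)

lemma smooth_manifold_chart: "smooth_manifold M \<Longrightarrow> c \<in> atlas M \<Longrightarrow> is_chart (mtop M) c"
  by (simp add: smooth_manifold_def)

lemma smooth_manifold_finite_basis:
  fixes M :: "('p, 'e::real_normed_vector) manifold"
  assumes "smooth_manifold M"
  obtains B :: "'e set" where "finite B" "independent B" "span B = UNIV" "card B = mdim M"
proof -
  obtain A :: "'e set" where A: "finite A" "span A = UNIV"
    using assms by (auto simp: smooth_manifold_def)
  obtain B :: "'e set" where B: "B \<subseteq> UNIV" "independent B" "UNIV \<subseteq> span B" "card B = dim (UNIV :: 'e set)"
    by (rule basis_exists)
  moreover have "finite B" using independent_span_bound[OF A(1) B(2)] A(2) by auto
  ultimately show thesis by (intro that[of B]) (auto simp: mdim_def)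
qed

lemma chart_at_in:
  assumes "smooth_manifold M" "p \<in> points M"
  shows "chart_at M p \<in> charts_at M p"
proof -
  from assms have "p \<in> (\<Union>c\<in>atlas M. fst c)" by (simp only: smooth_manifold_def)
  then have "\<exists>c. c \<in> charts_at M p" unfolding charts_at_def by blast
  then show ?thesis unfolding chart_at_def by (rule someI_ex)
qed

lemma charts_at_point: "smooth_manifold M \<Longrightarrow> c \<in> charts_at M p \<Longrightarrow> p \<in> points M"
  by (auto simp: smooth_manifold_def charts_at_def)

text \<open>This set is the domain of the coordinate expression of \<open>f\<close>; its openness
  permits comparing derivatives at its points.\<close>

lemma openin_chart_preimage:
  assumes "smooth_manifold M" "smooth_manifold N" "continuous_map (mtop M) (mtop N) f"
    and "c \<in> atlas M" "d \<in> atlas N"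
  shows "openin (mtop M) {p \<in> fst c. f p \<in> fst d}"
proof -
  have c: "openin (mtop M) (fst c)" and d: "openin (mtop N) (fst d)"
    using assms smooth_manifold_chart chart_openin by metis+
  have "openin (mtop M) (fst c \<inter> {p \<in> points M. f p \<in> fst d})"
    using c openin_continuous_map_preimage[OF assms(3) d] by (rule openin_Int)
  also have "fst c \<inter> {p \<in> points M. f p \<in> fst d} = {p \<in> fst c. f p \<in> fst d}"
    using openin_subset[OF c] by auto
  finally show ?thesis .
qed

text \<open>Three derivatives in one: for \<open>g = snd d\<close> the Jacobian of a change of
  coordinates, for \<open>g = snd d \<circ> f\<close> that of a map, and for real-valued
  \<open>g\<close> the differential in coordinates.\<close>

definition chart_deriv ::
    "('p, 'e::real_normed_vector) chart \<Rightarrow> ('p \<Rightarrow> 'g::real_normed_vector) \<Rightarrow> 'p \<Rightarrow> 'e \<Rightarrow> 'g" where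
  "chart_deriv c g p = frechet_derivative (g \<circ> chart_inv c) (at (snd c p))"

section \<open>Differentiability in charts and the chain rule\<close>

lemma smooth_on_differentiable: "smooth_on S f \<Longrightarrow> x \<in> S \<Longrightarrow> f differentiable at x"
  unfolding smooth_on_def using Ck_on.simps(2) by blast

lemma smooth_map_differentiable:
  assumes "smooth_map M N f" "c \<in> charts_at M p" "d \<in> charts_at N (f p)"
  shows "(snd d \<circ> f \<circ> chart_inv c) differentiable at (snd c p)"
  using assms by (intro smooth_on_differentiable[of "snd c ` {p \<in> fst c. f p \<in> fst d}"])
    (auto simp: smooth_map_def charts_at_def)

lemma smooth_function_differentiable:
  assumes "smooth_function M h" "c \<in> charts_at M p"
  shows "(h \<circ> chart_inv c) differentiable at (snd c p)"
  using assms by (intro smooth_on_differentiable[of "snd c ` fst c"])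
    (auto simp: smooth_function_def charts_at_def)

text \<open>Compatibility of charts is smoothness of the identity, so facts about transition maps
  are the case \<open>f = id\<close> of facts about smooth maps.\<close>

lemma smooth_map_id:
  assumes "smooth_manifold M"
  shows "smooth_map M M id"
proof -
  have "snd c ` {p \<in> fst c. id p \<in> fst d} = snd c ` (fst c \<inter> fst d)" for c d :: "('a, 'b) chart"
    by auto
  then show ?thesis
    using assms by (simp add: smooth_map_def smooth_manifold_def compatible_charts_def)
qed

text \<open>On the open coordinate image of \<open>U\<close>, where \<open>f\<close> lands in the
  domain of \<open>d\<close>, inserting \<open>chart_inv d \<circ> snd d\<close> changes nothing;
  the ordinary chain rule then applies.\<close>

lemma chart_deriv_chain:
  assumes M: "smooth_manifold M" and N: "smooth_manifold N" and f: "smooth_map M N f"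
    and c: "c \<in> charts_at M p" and d: "d \<in> charts_at N (f p)"
    and h: "(h \<circ> chart_inv d) differentiable at (snd d (f p))"
  shows "(h \<circ> f \<circ> chart_inv c) differentiable at (snd c p)"
    and "chart_deriv c (h \<circ> f) p = chart_deriv d h (f p) \<circ> chart_deriv c (snd d \<circ> f) p"
proof -
  have cd: "c \<in> atlas M" "p \<in> fst c" "d \<in> atlas N" "f p \<in> fst d"
    using c d by (auto simp: charts_at_def)
  note charts = smooth_manifold_chart[OF M cd(1)] smooth_manifold_chart[OF N cd(3)]
  define U where "U = {p \<in> fst c. f p \<in> fst d}"
  have "openin (mtop M) U"
    unfolding U_def using f by (intro openin_chart_preimage[OF M N _ cd(1,3)]) (simp add: smooth_map_def)
  then have U: "open (snd c ` U)" by (rule open_chart_image[OF charts(1)]) (auto simp: U_def)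
  have in_U: "snd c p \<in> snd c ` U" using cd by (auto simp: U_def)
  have inv: "chart_inv c (snd c p) = p" using charts(1) cd(2) by (rule chart_inv_eq)
  let ?g = "snd d \<circ> f \<circ> chart_inv c"
  have g: "(?g has_derivative chart_deriv c (snd d \<circ> f) p) (at (snd c p))"
    using smooth_map_differentiable[OF f c d] by (simp add: chart_deriv_def frechet_derivative_works)
  have h: "(h \<circ> chart_inv d has_derivative chart_deriv d h (f p)) (at (?g (snd c p)))"
    using h by (simp add: chart_deriv_def frechet_derivative_works inv)
  have "(h \<circ> f \<circ> chart_inv c has_derivative
      chart_deriv d h (f p) \<circ> chart_deriv c (snd d \<circ> f) p) (at (snd c p))"
  proof (rule has_derivative_transform_within_open[OF diff_chain_at[OF g h] U in_U])
    fix x assume "x \<in> snd c ` U"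
    then show "((h \<circ> chart_inv d) \<circ> ?g) x = (h \<circ> f \<circ> chart_inv c) x"
      using chart_inv_eq[OF charts(1)] chart_inv_eq[OF charts(2)] by (auto simp: U_def)
  qed
  then show "(h \<circ> f \<circ> chart_inv c) differentiable at (snd c p)"
    "chart_deriv c (h \<circ> f) p = chart_deriv d h (f p) \<circ> chart_deriv c (snd d \<circ> f) p"
    unfolding chart_deriv_def differentiable_def by (blast, rule frechet_derivative_at[symmetric])
qed

lemma linear_chart_deriv:
  "(g \<circ> chart_inv c) differentiable at (snd c p) \<Longrightarrow> linear (chart_deriv c g p)"
  unfolding chart_deriv_def by (rule linear_frechet_derivative)

lemma transition_differentiable:
  assumes "smooth_manifold M" "c \<in> charts_at M p" "d \<in> charts_at M p"
  shows "(snd d \<circ> chart_inv c) differentiable at (snd c p)"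
  using smooth_map_differentiable[OF smooth_map_id[OF assms(1)], of c p d] assms by simp

lemma chart_deriv_transition:
  assumes "smooth_manifold M" "c \<in> charts_at M p" "d \<in> charts_at M p" "e \<in> charts_at M p"
  shows "chart_deriv c (snd e) p = chart_deriv d (snd e) p \<circ> chart_deriv c (snd d) p"
  using chart_deriv_chain(2)[OF assms(1,1) smooth_map_id[OF assms(1)], of c p d "snd e"]
    transition_differentiable[OF assms(1,3,4)] assms by simp

lemma chart_deriv_self:
  assumes "smooth_manifold M" "c \<in> charts_at M p"
  shows "chart_deriv c (snd c) p = id"
proof -
  have c: "is_chart (mtop M) c" "p \<in> fst c"
    using assms(2) smooth_manifold_chart[OF assms(1)] by (simp_all add: charts_at_def)
  have "open (snd c ` fst c)" using open_chart_image[OF c(1) chart_openin[OF c(1)]] by simp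
  then have "(snd c \<circ> chart_inv c has_derivative id) (at (snd c p))"
    using c by (intro has_derivative_transform_within_open[OF has_derivative_id, of "snd c ` fst c"])
      (auto simp: chart_inv_eq)
  then show ?thesis unfolding chart_deriv_def by (rule frechet_derivative_at[symmetric])
qed

subsection \<open>Tangent vectors in coordinates\<close>

lemma tangent_space_iff:
  "v \<in> tangent_space M p \<longleftrightarrow>
    (\<forall>c\<in>charts_at M p. \<forall>d\<in>charts_at M p. v d = chart_deriv c (snd d) p (v c)) \<and>
    (\<forall>c. c \<notin> charts_at M p \<longrightarrow> v c = 0)"
  unfolding tangent_space_def chart_deriv_def by (rule mem_Collect_eq)

lemma tangent_space_transition:
  assumes "v \<in> tangent_space M p" "c \<in> charts_at M p" "d \<in> charts_at M p"
  shows "v d = chart_deriv c (snd d) p (v c)"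
  using assms unfolding tangent_space_iff by blast

lemma coord_vec_apply:
  "coord_vec M c p a d = (if d \<in> charts_at M p then chart_deriv c (snd d) p a else 0)"
  by (simp add: coord_vec_def chart_deriv_def)

text \<open>The transformation law is the cocycle identity
  \<open>chart_deriv_transition\<close>.\<close>

lemma coord_vec_tangent:
  assumes "smooth_manifold M" "c \<in> charts_at M p"
  shows "coord_vec M c p a \<in> tangent_space M p"
  using chart_deriv_transition[OF assms, symmetric, THEN fun_cong]
  by (simp add: tangent_space_iff coord_vec_apply)

lemma coord_vec_self:
  assumes "smooth_manifold M" "c \<in> charts_at M p"
  shows "coord_vec M c p a c = a"
  using chart_deriv_self[OF assms] assms(2) by (simp add: coord_vec_apply)

text \<open>Together with \<open>coord_vec_self\<close>, this makes \<open>coord_vec M c p\<close> a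
  bijection from the model space onto the tangent space, with evaluation at \<open>c\<close> as
  inverse.\<close>

lemma coord_vec_component:
  assumes "v \<in> tangent_space M p" "c \<in> charts_at M p"
  shows "coord_vec M c p (v c) = v"
proof
  fix d
  show "coord_vec M c p (v c) d = v d"
  proof (cases "d \<in> charts_at M p")
    case True
    then show ?thesis using tangent_space_transition[OF assms True] by (simp add: coord_vec_apply)
  next
    case False
    then have "v d = 0" using assms(1) unfolding tangent_space_iff by blast
    with False show ?thesis by (simp add: coord_vec_apply)
  qed
qed

text \<open>Linearity in the pointwise shape used by \<open>two_form\<close>, so that a form can be
  transported to the model space.\<close>

lemma coord_vec_combination:
  assumes "smooth_manifold M" "c \<in> charts_at M p"
  shows "coord_vec M c p (r *\<^sub>R a + s *\<^sub>R b)
    = (\<lambda>d. r *\<^sub>R coord_vec M c p a d + s *\<^sub>R coord_vec M c p b d)"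
proof
  fix d
  show "coord_vec M c p (r *\<^sub>R a + s *\<^sub>R b) d
    = r *\<^sub>R coord_vec M c p a d + s *\<^sub>R coord_vec M c p b d"
    using linear_chart_deriv[OF transition_differentiable[OF assms, of d]]
    by (simp add: coord_vec_apply linear_add linear_scale)
qed

section \<open>Tangent maps and differentials in coordinates\<close>

lemma tangent_map_component:
  assumes M: "smooth_manifold M" and N: "smooth_manifold N" and f: "smooth_map M N f"
    and v: "v \<in> tangent_space M p" and c: "c \<in> charts_at M p" and d: "d \<in> charts_at N (f p)"
  shows "tangent_map M N f p v d = chart_deriv c (snd d \<circ> f) p (v c)"
proof -
  let ?c = "chart_at M p"
  have "p \<in> points M" using M c by (rule charts_at_point)
  with M have c': "?c \<in> charts_at M p" by (rule chart_at_in)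
  \<comment> \<open>Splitting off the identity brings in the chosen chart \<open>?c\<close> as
    intermediate chart; the transformation law of \<open>v\<close> then absorbs the transition
    Jacobian.\<close>
  have "chart_deriv c ((snd d \<circ> f) \<circ> id) p
      = chart_deriv ?c (snd d \<circ> f) (id p) \<circ> chart_deriv c (snd ?c \<circ> id) p"
    using c c' d by (intro chart_deriv_chain(2)[OF M M smooth_map_id[OF M]])
      (auto intro: smooth_map_differentiable[OF f])
  then have "chart_deriv c (snd d \<circ> f) p (v c) = chart_deriv ?c (snd d \<circ> f) p (v ?c)"
    using tangent_space_transition[OF v c c'] by simp
  then show ?thesis
    using d by (simp add: tangent_map_def Let_def chart_deriv_def)
qed

text \<open>Changing the target chart composes the Jacobian of \<open>f\<close> with the transition
  Jacobian, which is the transformation law on \<open>N\<close>.\<close>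

lemma tangent_map_tangent:
  assumes M: "smooth_manifold M" and N: "smooth_manifold N" and f: "smooth_map M N f"
    and v: "v \<in> tangent_space M p" and p: "p \<in> points M"
  shows "tangent_map M N f p v \<in> tangent_space N (f p)"
proof -
  let ?c = "chart_at M p"
  have c: "?c \<in> charts_at M p" using M p by (rule chart_at_in)
  have "tangent_map M N f p v e = chart_deriv d (snd e) (f p) (tangent_map M N f p v d)"
    if "d \<in> charts_at N (f p)" "e \<in> charts_at N (f p)" for d e
    using that chart_deriv_chain(2)[OF M N f c that(1) transition_differentiable[OF N that]]
    by (simp add: tangent_map_component[OF M N f v c])
  moreover have "tangent_map M N f p v e = 0" if "e \<notin> charts_at N (f p)" for e
    using that by (simp add: tangent_map_def Let_def)
  ultimately show ?thesis unfolding tangent_space_iff by blast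
qed

lemma differential_compose:
  assumes M: "smooth_manifold M" and N: "smooth_manifold N" and f: "smooth_map M N f"
    and h: "smooth_function N h" and v: "v \<in> tangent_space M p" and p: "p \<in> points M"
  shows "differential M (h \<circ> f) p v = differential N h (f p) (tangent_map M N f p v)"
proof -
  let ?c = "chart_at M p" and ?d = "chart_at N (f p)"
  have c: "?c \<in> charts_at M p" using M p by (rule chart_at_in)
  have "f p \<in> points N" using f p by (auto simp: smooth_map_def continuous_map_def)
  with N have d: "?d \<in> charts_at N (f p)" by (rule chart_at_in)
  have "chart_deriv ?c (h \<circ> f) p (v ?c)
      = chart_deriv ?d h (f p) (tangent_map M N f p v ?d)"
    using chart_deriv_chain(2)[OF M N f c d smooth_function_differentiable[OF h d]]
    by (simp add: tangent_map_component[OF M N f v c d])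
  then show ?thesis by (simp add: differential_def Let_def chart_deriv_def)
qed

text \<open>Under the coordinate bijections the tangent map becomes the Jacobian, so questions about
  its image and kernel reduce to linear algebra in the model spaces.\<close>

lemma tangent_map_coord_vec:
  assumes M: "smooth_manifold M" and N: "smooth_manifold N" and f: "smooth_map M N f"
    and c: "c \<in> charts_at M p" and d: "d \<in> charts_at N (f p)"
  shows "tangent_map M N f p (coord_vec M c p a)
    = coord_vec N d (f p) (chart_deriv c (snd d \<circ> f) p a)"
proof -
  let ?v = "coord_vec M c p a"
  have v: "?v \<in> tangent_space M p" using M c by (rule coord_vec_tangent)
  have p: "p \<in> points M" using M c by (rule charts_at_point)
  have "coord_vec N d (f p) (tangent_map M N f p ?v d) = tangent_map M N f p ?v"
    using tangent_map_tangent[OF M N f v p] d by (rule coord_vec_component)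
  then show ?thesis
    by (simp add: tangent_map_component[OF M N f v c d] coord_vec_self[OF M c])
qed

lemma linear_chart_deriv_map:
  assumes "smooth_map M N f" "c \<in> charts_at M p" "d \<in> charts_at N (f p)"
  shows "linear (chart_deriv c (snd d \<circ> f) p)"
  using smooth_map_differentiable[OF assms] by (rule linear_chart_deriv)

lemma inj_chart_deriv_embedding:
  assumes M: "smooth_manifold M" and N: "smooth_manifold N" and f: "smooth_embedding M N f"
    and c: "c \<in> charts_at M p" and d: "d \<in> charts_at N (f p)"
  shows "inj (chart_deriv c (snd d \<circ> f) p)"
proof (rule injI)
  fix a b assume eq: "chart_deriv c (snd d \<circ> f) p a = chart_deriv c (snd d \<circ> f) p b"
  have smooth: "smooth_map M N f" and inj: "inj_on (tangent_map M N f p) (tangent_space M p)"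
    using f charts_at_point[OF M c] by (auto simp: smooth_embedding_def)
  have "tangent_map M N f p (coord_vec M c p a) = tangent_map M N f p (coord_vec M c p b)"
    by (simp add: tangent_map_coord_vec[OF M N smooth c d] eq)
  then have "coord_vec M c p a = coord_vec M c p b"
    using inj coord_vec_tangent[OF M c] by (simp add: inj_on_eq_iff)
  then show "a = b" using coord_vec_self[OF M c] by metis
qed

subsection \<open>The slicing equation\<close>

text \<open>In coordinates the image of T\<alpha> is spanned by the images of a basis under the
  injective Jacobian \<open>A\<close>. It is isotropic of half the dimension, so maximality puts the
  orthogonal vector \<open>w\<close> into it.\<close>

lemma lagrangian_tangent_image:
  fixes P :: "('p, 'f::real_normed_vector) manifold" and M :: "('m, 'e::real_normed_vector) manifold"
  assumes symp: "symplectic_manifold P \<omega>" and M: "smooth_manifold M"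
    and emb: "smooth_embedding M P \<alpha>" and lagr: "lagrangian M P \<omega> \<alpha>" and m: "m \<in> points M"
    and w: "w \<in> tangent_space P (\<alpha> m)"
    and orth: "\<And>v. v \<in> tangent_space M m \<Longrightarrow> \<omega> (\<alpha> m) w (tangent_map M P \<alpha> m v) = 0"
  obtains v where "v \<in> tangent_space M m" "tangent_map M P \<alpha> m v = w"
proof -
  let ?q = "\<alpha> m"
  have P: "smooth_manifold P" and form: "two_form P \<omega>" and nondeg: "nondegenerate_form P \<omega>"
    using symp by (auto simp: symplectic_manifold_def)
  have \<alpha>: "smooth_map M P \<alpha>" using emb by (simp add: smooth_embedding_def)
  have q: "?q \<in> points P" using \<alpha> m by (auto simp: smooth_map_def continuous_map_def)
  define c where "c = chart_at M m"
  define d where "d = chart_at P ?q"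
  have c: "c \<in> charts_at M m" unfolding c_def using M m by (rule chart_at_in)
  have d: "d \<in> charts_at P ?q" unfolding d_def using P q by (rule chart_at_in)
  define A where "A = chart_deriv c (snd d \<circ> \<alpha>) m"
  have A: "linear A" "inj A"
    unfolding A_def using linear_chart_deriv_map[OF \<alpha> c d] inj_chart_deriv_embedding[OF M P emb c d] .
  have TA: "tangent_map M P \<alpha> m (coord_vec M c m a) = coord_vec P d ?q (A a)" for a
    unfolding A_def by (rule tangent_map_coord_vec[OF M P \<alpha> c d])
  \<comment> \<open>\<open>W\<close> is \<omega> at \<alpha>(m) carried to the model space by the
    chart \<open>d\<close>.\<close>
  define W where "W a b = \<omega> ?q (coord_vec P d ?q a) (coord_vec P d ?q b)" for a b
  note cv = coord_vec_tangent[OF P d]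
  have alt: "\<omega> ?q u v = - \<omega> ?q v u"
    if "u \<in> tangent_space P ?q" "v \<in> tangent_space P ?q" for u v
    using form q that unfolding two_form_def by blast
  have lin: "\<omega> ?q (\<lambda>c. r *\<^sub>R u c + s *\<^sub>R v c) x = r * \<omega> ?q u x + s * \<omega> ?q v x"
    if "u \<in> tangent_space P ?q" "v \<in> tangent_space P ?q" "x \<in> tangent_space P ?q" for u v x r s
    using form q that unfolding two_form_def by blast
  have W_comb: "W (r *\<^sub>R a + s *\<^sub>R b) v = r * W a v + s * W b v" for a b v r s
    unfolding W_def coord_vec_combination[OF P d] by (intro lin cv)
  have W_lin: "linear (\<lambda>u. W u v)" for v
  proof (rule linearI)
    show "W (a + b) v = W a v + W b v" for a b using W_comb[of 1 a 1 b] by simp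
    show "W (r *\<^sub>R a) v = r *\<^sub>R W a v" for r a using W_comb[of r a 0 0] by simp
  qed
  have W_alt: "W u v = - W v u" for u v unfolding W_def by (intro alt cv)
  have W_nondeg: "u = 0" if u: "\<And>v. W u v = 0" for u
  proof -
    have "\<omega> ?q (coord_vec P d ?q u) v = 0" if v: "v \<in> tangent_space P ?q" for v
      using u[of "v d"] by (simp add: W_def coord_vec_component[OF v d])
    with nondeg q cv have "coord_vec P d ?q u = (\<lambda>_. 0)"
      unfolding nondegenerate_form_def by blast
    then show ?thesis using coord_vec_self[OF P d, of u] by simp
  qed
  obtain B :: "'e set" where B: "finite B" "independent B" "span B = UNIV" "card B = mdim M"
    using M by (rule smooth_manifold_finite_basis)
  obtain D :: "'f set" where D: "finite D" "span D = UNIV"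
    using P by (rule smooth_manifold_finite_basis)
  have iso: "W (A a) (A b) = 0" for a b
    using lagr m coord_vec_tangent[OF M c]
    by (simp add: W_def lagrangian_def isotropic_def pullback2_def flip: TA)
  have orth_A: "W (w d) (A a) = 0" for a
    using orth[OF coord_vec_tangent[OF M c]] by (simp add: W_def coord_vec_component[OF w d] flip: TA)
  have "w d \<in> span (A ` B)"
  proof (rule lagrangian_subspace_maximal[OF W_lin W_alt W_nondeg D])
    show "independent (A ` B)"
      using A B by (intro linear_independent_injective_image) (auto intro: inj_on_subset)
    have "card (A ` B) = mdim M" using A B by (simp add: card_image inj_on_subset)
    then show "dim (UNIV :: 'f set) = 2 * card (A ` B)"
      using lagr by (simp add: lagrangian_def mdim_def)
  qed (use B iso orth_A in auto)
  then obtain a where a: "w d = A a"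
    using A(1) B(3) by (auto simp: linear_span_image)
  show thesis
  proof (rule that[OF coord_vec_tangent[OF M c]])
    show "tangent_map M P \<alpha> m (coord_vec M c m a) = w"
      by (simp add: TA coord_vec_component[OF w d] flip: a)
  qed
qed

text \<open>In charts the equation for \<open>X\<close> is a linear system: the columns are the
  directional derivatives of \<alpha> along a basis, the right-hand side is \<open>Z\<close> along
  \<alpha>. The columns are independent because T\<alpha> is injective, so
  \<open>Ck_on_coefficients\<close> makes the solution smooth.\<close>

lemma vector_field_tangent_preimage:
  fixes P :: "('p, 'f::real_normed_vector) manifold" and M :: "('m, 'e::real_normed_vector) manifold"
  assumes M: "smooth_manifold M" and P: "smooth_manifold P"
    and emb: "smooth_embedding M P \<alpha>" and Z: "vector_field P Z"
    and X: "\<And>m. m \<in> points M \<Longrightarrow> X m \<in> tangent_space M m"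
    and X_Z: "\<And>m. m \<in> points M \<Longrightarrow> tangent_map M P \<alpha> m (X m) = Z (\<alpha> m)"
  shows "vector_field M X"
proof -
  have \<alpha>: "smooth_map M P \<alpha>" using emb by (simp add: smooth_embedding_def)
  obtain B :: "'e set" where B: "finite B" "independent B" "span B = UNIV"
    using M by (rule smooth_manifold_finite_basis)
  obtain D :: "'f set" where D: "finite D" "independent D" "span D = UNIV"
    using P by (rule smooth_manifold_finite_basis)
  have "Ck_on k (snd c ` fst c) (\<lambda>x. X (chart_inv c x) c)" if c: "c \<in> atlas M" for c k
  proof (rule Ck_on_local)
    fix x assume "x \<in> snd c ` fst c"
    then obtain p where p: "p \<in> fst c" "x = snd c p" by blast
    have chart_c: "is_chart (mtop M) c" using M c by (rule smooth_manifold_chart)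
    have points: "q \<in> points M" if "q \<in> fst c" for q
      using that openin_subset[OF chart_openin[OF chart_c]] by blast
    have "\<alpha> p \<in> points P" using \<alpha> points[OF p(1)] by (auto simp: smooth_map_def continuous_map_def)
    with P have "chart_at P (\<alpha> p) \<in> charts_at P (\<alpha> p)" by (rule chart_at_in)
    then obtain d where d: "d \<in> atlas P" "\<alpha> p \<in> fst d" unfolding charts_at_def by blast
    have chart_d: "is_chart (mtop P) d" using P d(1) by (rule smooth_manifold_chart)
    define V where "V = {q \<in> fst c. \<alpha> q \<in> fst d}"
    define U where "U = snd c ` V"
    have "openin (mtop M) V"
      unfolding V_def using \<alpha>
      by (intro openin_chart_preimage[OF M P _ c d(1)]) (simp add: smooth_map_def)
    then have U: "open U" unfolding U_def by (rule open_chart_image[OF chart_c]) (auto simp: V_def)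
    have inv: "chart_inv c (snd c q) = q" if "q \<in> V" for q
      using that by (intro chart_inv_eq[OF chart_c]) (simp add: V_def)
    define g where "g = snd d \<circ> \<alpha> \<circ> chart_inv c"
    \<comment> \<open>All orders are needed: the columns of the system are derivatives of
      \<open>g\<close> and so cost one order.\<close>
    have g: "Ck_on k U g" for k
      using \<alpha> c d(1) by (auto simp: smooth_map_def smooth_on_def g_def U_def V_def)
    have "Ck_on k (snd d ` fst d) (\<lambda>y. Z (chart_inv d y) d)"
      using Z d(1) by (auto simp: vector_field_def smooth_on_def)
    then have z: "Ck_on k U ((\<lambda>y. Z (chart_inv d y) d) \<circ> g)"
      by (rule Ck_on_compose[OF D U g]) (auto simp: g_def U_def inv V_def)
    \<comment> \<open>The unknowns of the system are the coordinates of \<open>X\<close> with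
      respect to the basis \<open>B\<close>.\<close>
    define r where "r b x = representation B (X (chart_inv c x) c) b" for b x
    have r: "(\<Sum>b\<in>B. r b x *\<^sub>R b) = X (chart_inv c x) c" for x
      unfolding r_def using B by (simp add: sum_representation_eq)
    have deriv: "(\<Sum>b\<in>B. t b *\<^sub>R frechet_derivative g (at x) b)
        = chart_deriv c (snd d \<circ> \<alpha>) q (\<Sum>b\<in>B. t b *\<^sub>R b)"
      "linear (chart_deriv c (snd d \<circ> \<alpha>) q)" "inj (chart_deriv c (snd d \<circ> \<alpha>) q)"
      if "q \<in> V" "x = snd c q" for q x t
    proof -
      have charts: "c \<in> charts_at M q" "d \<in> charts_at P (\<alpha> q)"
        using that(1) c d by (auto simp: V_def charts_at_def)
      show lin: "linear (chart_deriv c (snd d \<circ> \<alpha>) q)" using \<alpha> charts by (rule linear_chart_deriv_map)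
      show "inj (chart_deriv c (snd d \<circ> \<alpha>) q)" using M P emb charts by (rule inj_chart_deriv_embedding)
      show "(\<Sum>b\<in>B. t b *\<^sub>R frechet_derivative g (at x) b)
        = chart_deriv c (snd d \<circ> \<alpha>) q (\<Sum>b\<in>B. t b *\<^sub>R b)"
        using that(2) by (simp add: linear_sum[OF lin] linear_scale[OF lin]) (simp add: chart_deriv_def g_def)
    qed
    have "Ck_on k U (r b)" if "b \<in> B" for b
    proof (rule Ck_on_coefficients[OF D(1,3) B(1) U _ z _ _ that,
          where F = "\<lambda>b x. frechet_derivative g (at x) b"])
      show "Ck_on k U (\<lambda>x. frechet_derivative g (at x) b)" for b
        by (rule Ck_on_SucD(2)[OF g])
      fix x assume "x \<in> U"
      then obtain q where q: "q \<in> V" "x = snd c q" by (auto simp: U_def)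
      note deriv = deriv[OF q]
      show "(\<Sum>b\<in>B. r b x *\<^sub>R frechet_derivative g (at x) b) = ((\<lambda>y. Z (chart_inv d y) d) \<circ> g) x"
      proof -
        have q': "q \<in> points M" "c \<in> charts_at M q" "d \<in> charts_at P (\<alpha> q)" "\<alpha> q \<in> fst d"
          using q(1) points c d by (auto simp: V_def charts_at_def)
        have "(\<Sum>b\<in>B. r b x *\<^sub>R frechet_derivative g (at x) b) = chart_deriv c (snd d \<circ> \<alpha>) q (X q c)"
          unfolding deriv(1) r using q by (simp add: inv)
        also have "\<dots> = Z (\<alpha> q) d"
          using tangent_map_component[OF M P \<alpha> X q'(2,3)] X_Z q'(1) by simp
        finally show ?thesis
          using q q'(4) by (simp add: g_def inv chart_inv_eq[OF chart_d])
      qed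
      fix t :: "'e \<Rightarrow> real" and i
      assume "(\<Sum>b\<in>B. t b *\<^sub>R frechet_derivative g (at x) b) = 0" and i: "i \<in> B"
      \<comment> \<open>By linearity the relation says that the Jacobian kills this vector;
        injectivity makes the vector zero, and independence of \<open>B\<close> then kills its
        coefficients.\<close>
      then have "(\<Sum>b\<in>B. t b *\<^sub>R b) = 0"
        using deriv by (simp add: linear_injective_0)
      then show "t i = 0"
        using independentD[OF B(2,1) subset_refl _ i] by blast
    qed
    then have "Ck_on k U (\<lambda>x. \<Sum>b\<in>B. r b x *\<^sub>R b)"
      by (intro Ck_on_sum Ck_on_scaleR Ck_on_const U)
    then have "Ck_on k U (\<lambda>x. X (chart_inv c x) c)" unfolding r .
    moreover have "x \<in> U" using p d(2) by (auto simp: U_def V_def)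
    ultimately show "\<exists>U. open U \<and> x \<in> U \<and> Ck_on k U (\<lambda>x. X (chart_inv c x) c)"
      using U by blast
  qed
  then show ?thesis using X by (simp add: vector_field_def smooth_on_def)
qed

theorem theorem3:
  fixes P :: "('p, 'f::real_normed_vector) manifold" and M :: "('m, 'e::real_normed_vector) manifold"
    and \<omega> :: "('p, 'f) form2" and H :: "'p \<Rightarrow> real" and Z :: "'p \<Rightarrow> ('p, 'f) tangent"
    and \<alpha> :: "'m \<Rightarrow> 'p"
  assumes "symplectic_manifold P \<omega>"
    and "smooth_function P H"
    and "hamiltonian_vector_field P \<omega> H Z"
    and "smooth_manifold M"
    and "smooth_embedding M P \<alpha>"
  shows "(slicing_solution M P Z \<alpha> \<and> isotropic M P \<omega> \<alpha> \<longrightarrow>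
            (\<forall>m\<in>points M. \<forall>v\<in>tangent_space M m. differential M (H \<circ> \<alpha>) m v = 0)) \<and>
         ((\<forall>m\<in>points M. \<forall>v\<in>tangent_space M m. differential M (H \<circ> \<alpha>) m v = 0) \<and>
            lagrangian M P \<omega> \<alpha> \<longrightarrow> slicing_solution M P Z \<alpha>)"
proof -
  have P: "smooth_manifold P" using assms(1) by (simp add: symplectic_manifold_def)
  have \<alpha>: "smooth_map M P \<alpha>" using assms(5) by (simp add: smooth_embedding_def)
  have Z: "vector_field P Z"
    and ham: "\<And>p v. p \<in> points P \<Longrightarrow> v \<in> tangent_space P p \<Longrightarrow> \<omega> p (Z p) v = differential P H p v"
    using assms(3) by (auto simp: hamiltonian_vector_field_def)
  have \<alpha>_points: "\<alpha> m \<in> points P" if "m \<in> points M" for m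
    using \<alpha> that by (auto simp: smooth_map_def continuous_map_def)
  \<comment> \<open>Both directions rest on this identity: the chain rule at \<open>m\<close>,
    followed by the defining equation of \<open>Z\<close> at \<alpha>(m).\<close>
  have dH: "differential M (H \<circ> \<alpha>) m v = \<omega> (\<alpha> m) (Z (\<alpha> m)) (tangent_map M P \<alpha> m v)"
    if "m \<in> points M" "v \<in> tangent_space M m" for m v
    using differential_compose[OF assms(4) P \<alpha> assms(2) that(2,1)]
      ham[OF \<alpha>_points[OF that(1)] tangent_map_tangent[OF assms(4) P \<alpha> that(2,1)]] by simp
  show ?thesis
  proof (intro conjI impI; elim conjE)
    assume "slicing_solution M P Z \<alpha>" and iso: "isotropic M P \<omega> \<alpha>"
    then obtain X where X: "vector_field M X"
      "\<And>m. m \<in> points M \<Longrightarrow> tangent_map M P \<alpha> m (X m) = Z (\<alpha> m)"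
      by (auto simp: slicing_solution_def)
    show "\<forall>m\<in>points M. \<forall>v\<in>tangent_space M m. differential M (H \<circ> \<alpha>) m v = 0"
    proof (intro ballI)
      fix m v assume m: "m \<in> points M" and v: "v \<in> tangent_space M m"
      have "X m \<in> tangent_space M m" using X(1) m by (simp add: vector_field_def)
      then have "\<omega> (\<alpha> m) (tangent_map M P \<alpha> m (X m)) (tangent_map M P \<alpha> m v) = 0"
        using iso m v by (simp add: isotropic_def pullback2_def)
      then show "differential M (H \<circ> \<alpha>) m v = 0" using dH[OF m v] X(2)[OF m] by simp
    qed
  next
    assume d0: "\<forall>m\<in>points M. \<forall>v\<in>tangent_space M m. differential M (H \<circ> \<alpha>) m v = 0"
      and lagr: "lagrangian M P \<omega> \<alpha>"
    have "\<exists>v. v \<in> tangent_space M m \<and> tangent_map M P \<alpha> m v = Z (\<alpha> m)" if m: "m \<in> points M" for m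
    proof -
      have "Z (\<alpha> m) \<in> tangent_space P (\<alpha> m)"
        using Z \<alpha>_points[OF m] by (simp add: vector_field_def)
      from lagrangian_tangent_image[OF assms(1,4,5) lagr m this] show ?thesis
        using d0 m dH[OF m] by metis
    qed
    \<comment> \<open>The choice is made point by point without any regularity; smoothness follows
      afterwards from that of \<open>Z\<close> and the injectivity of T\<alpha>.\<close>
    then obtain X where X: "\<And>m. m \<in> points M \<Longrightarrow> X m \<in> tangent_space M m"
      "\<And>m. m \<in> points M \<Longrightarrow> tangent_map M P \<alpha> m (X m) = Z (\<alpha> m)"
      by metis
    have "vector_field M X"
      using assms(4) P assms(5) Z X by (rule vector_field_tangent_preimage)
    then show "slicing_solution M P Z \<alpha>"
      using X(2) by (auto simp: slicing_solution_def)
  qed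
qed

end
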